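(* Let $Y$ be a locally compact Tychonoff $s_{\mathbb{R}}$-space, and let $X$ be a Tychonoff $s_{\mathbb{R}}$-space. Then $X\times Y$ is an $s_{\mathbb{R}}$-space.
   Context: All spaces are assumed to be Tychonoff. A function $f:X\to\mathbb{R}$ is sequentially continuous ($s$-continuous) if the restriction of $f$ to each convergent sequence in $X$ (together with its limit) is continuous. A space $X$ is an $s_{\mathbb{R}}$-space if every sequentially continuous function $f:X\to\mathbb{R}$ is continuous. *)

theory Defs
  imports "HOL-Analysis.Analysis"
begin

definition tychonoff_space :: "'a topology \<Rightarrow> bool" where
  "tychonoff_space X \<longleftrightarrow> completely_regular_space X \<and> Hausdorff_space X"

text \<open>The restriction of the function to every convergent sequence, taken together with its limit
  as a subspace of the domain, is continuous. The function is a total HOL function, but only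
  its values on the underlying set of the space matter.\<close>

definition s_continuous :: "'a topology \<Rightarrow> ('a \<Rightarrow> real) \<Rightarrow> bool" where
  "s_continuous X f \<longleftrightarrow>
     (\<forall>\<sigma> l. range \<sigma> \<subseteq> topspace X \<and> limitin X \<sigma> l sequentially \<longrightarrow>
        continuous_map (subtopology X (insert l (range \<sigma>))) euclideanreal f)"

definition sR_space :: "'a topology \<Rightarrow> bool" where
  "sR_space X \<longleftrightarrow> (\<forall>f. s_continuous X f \<longrightarrow> continuous_map X euclideanreal f)"

end

theory Submission imports Defs begin

text \<open>Let \<open>f\<close> be sequentially continuous on \<open>X \<times> Y\<close>. It is separately continuous. If
  \<open>x\<^sub>n \<longrightarrow> x\<close> in \<open>X\<close>, then each \<open>G\<^sub>m(y) = sup\<^bsub>n \<ge> m\<^esub> \<bar>f(x\<^sub>n, y) - f(x, y)\<bar>\<close> is sequentially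
  continuous, hence continuous, on \<open>Y\<close>; as \<open>G\<^sub>m\<close> decreases to \<open>0\<close>, Dini's argument makes the
  convergence \<open>f(x\<^sub>n, \<cdot>) \<longrightarrow> f(x, \<cdot>)\<close> uniform on each compact \<open>K \<subseteq> Y\<close>. Consequently
  \<open>x \<mapsto> sup\<^bsub>y \<in> K\<^esub> \<bar>f(x, y) - f(x\<^sub>0, y)\<bar>\<close> is sequentially continuous, hence continuous, on \<open>X\<close>.
  Taking for \<open>K\<close> a compact neighbourhood of \<open>y\<^sub>0\<close> gives continuity of \<open>f\<close> at \<open>(x\<^sub>0, y\<^sub>0)\<close>.\<close>

section \<open>Sequential continuity through limits of sequences, and bounds for suprema\<close>

lemma continuous_map_real_iff:
  fixes f :: "'a \<Rightarrow> real"
  shows "continuous_map X euclideanreal f \<longleftrightarrow>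
    (\<forall>x\<in>topspace X. \<forall>e>0. \<exists>U. openin X U \<and> x \<in> U \<and> (\<forall>y\<in>U. \<bar>f y - f x\<bar> < e))"
  using Met_TC.continuous_map_to_metric[of X f]
  by (simp add: dist_real_def abs_minus_commute Ball_def)

lemma s_continuous_imp_tendsto:
  assumes "s_continuous X f" and \<sigma>: "range \<sigma> \<subseteq> topspace X" "limitin X \<sigma> l sequentially"
  shows "(\<lambda>n. f (\<sigma> n)) \<longlonglongrightarrow> f l"
proof -
  let ?S = "subtopology X (insert l (range \<sigma>))"
  have "limitin ?S \<sigma> l sequentially"
    using \<sigma> by (simp add: limitin_subtopology)
  moreover have "continuous_map ?S euclideanreal f"
    using assms by (auto simp: s_continuous_def)
  ultimately have "limitin euclideanreal (f \<circ> \<sigma>) (f l) sequentially"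
    by (rule continuous_map_limit[rotated])
  then show ?thesis
    by (simp add: comp_def)
qed

text \<open>In a Hausdorff space every point of \<open>insert l (range \<sigma>)\<close> other than
  \<open>l\<close> is isolated in that subspace, so only continuity at \<open>l\<close> carries
  content. Together with \<open>s_continuous_imp_tendsto\<close> this replaces subspaces by limits
  in all later arguments.\<close>

lemma s_continuousI:
  fixes f :: "'a \<Rightarrow> real"
  assumes H: "Hausdorff_space X"
    and lim: "\<And>\<sigma> l. range \<sigma> \<subseteq> topspace X \<Longrightarrow> limitin X \<sigma> l sequentially \<Longrightarrow> (\<lambda>n. f (\<sigma> n)) \<longlonglongrightarrow> f l"
  shows "s_continuous X f"
  unfolding s_continuous_def
proof (intro allI impI, elim conjE)
  fix \<sigma> l assume ran: "range \<sigma> \<subseteq> topspace X" and l: "limitin X \<sigma> l sequentially"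
  let ?S = "insert l (range \<sigma>)"
  have minus_finite: "openin X (U - F)" if "openin X U" "finite F" for U F
  proof -
    have "closedin X (topspace X \<inter> F)"
      using Hausdorff_imp_t1_space[OF H] that(2) t1_space_closedin_finite by blast
    then have "openin X (U - topspace X \<inter> F)"
      using that(1) by blast
    moreover have "U - topspace X \<inter> F = U - F"
      using openin_subset[OF that(1)] by blast
    ultimately show ?thesis by simp
  qed
  have "\<exists>U. openin X U \<and> x \<in> U \<and> (\<forall>y\<in>U \<inter> ?S. \<bar>f y - f x\<bar> < e)"
    if x: "x \<in> ?S" and e: "e > 0" for x e
  proof (cases "x = l")
    case True
    obtain N where N: "\<And>n. n \<ge> N \<Longrightarrow> \<bar>f (\<sigma> n) - f l\<bar> < e"
      using lim[OF ran l] e by (auto simp: LIMSEQ_iff)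
    \<comment> \<open>The early terms are deleted, except that \<open>l\<close> must stay even if
      the sequence takes that value before \<open>N\<close>.\<close>
    let ?U = "topspace X - (\<sigma> ` {..<N} - {l})"
    have "openin X ?U"
      by (intro minus_finite) auto
    moreover have "x \<in> ?U"
      using l True by (auto simp: limitin_def)
    moreover have "\<bar>f y - f x\<bar> < e" if y: "y \<in> ?U \<inter> ?S" for y
    proof (cases "y = l")
      case False
      then obtain n where "y = \<sigma> n" "n \<ge> N"
        using y not_less by auto
      then show ?thesis using N True by simp
    qed (use e True in simp)
    ultimately show ?thesis by blast
  next
    case False
    have "x \<in> topspace X" "l \<in> topspace X"
      using x ran l by (auto simp: limitin_def)
    then obtain U V where UV: "openin X U" "openin X V" "x \<in> U" "l \<in> V" "disjnt U V"
      using H False unfolding Hausdorff_space_def by metis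
    obtain N where N: "\<And>n. n \<ge> N \<Longrightarrow> \<sigma> n \<in> V"
      using l UV unfolding limitin_def eventually_sequentially by blast
    \<comment> \<open>\<open>V\<close> contains \<open>l\<close> and all terms from \<open>N\<close>
      on, so \<open>U\<close> meets the subspace only in finitely many early terms; deleting those
      different from \<open>x\<close> isolates \<open>x\<close>.\<close>
    let ?U = "U - (\<sigma> ` {..<N} - {x})"
    have "openin X ?U"
      using UV by (intro minus_finite) auto
    moreover have "\<bar>f y - f x\<bar> < e" if y: "y \<in> ?U \<inter> ?S" for y
    proof -
      have "y \<notin> V"
        using y UV(5) by (auto simp: disjnt_iff)
      then obtain n where n: "y = \<sigma> n" "n < N"
        using y UV(4) N not_less by blast
      then have "y = x"
        using y by blast
      then show ?thesis
        using e by simp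
    qed
    ultimately show ?thesis
      using UV(3) by (intro exI[of _ ?U]) auto
  qed
  then show "continuous_map (subtopology X ?S) euclideanreal f"
    unfolding continuous_map_real_iff openin_subtopology
    by (simp, metis Int_iff insertCI)
qed

text \<open>Passing to suprema does not increase the uniform distance. This serves both the tail
  suprema over indices and the suprema over a compact set; boundedness enters because a real
  \<open>SUP\<close> is unspecified on unbounded sets.\<close>

lemma abs_cSUP_diff_le:
  fixes a b :: "'i \<Rightarrow> real"
  assumes "I \<noteq> {}" "bdd_above (a ` I)" "bdd_above (b ` I)"
    and ab: "\<And>i. i \<in> I \<Longrightarrow> \<bar>a i - b i\<bar> \<le> e"
  shows "\<bar>(SUP i\<in>I. a i) - (SUP i\<in>I. b i)\<bar> \<le> e"
proof -
  have "(SUP i\<in>I. a i) \<le> (SUP i\<in>I. b i) + e"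
  proof (rule cSUP_least[OF assms(1)])
    fix i assume "i \<in> I"
    then show "a i \<le> (SUP i\<in>I. b i) + e"
      using ab[of i] cSUP_upper[OF _ assms(3), of i] by linarith
  qed
  moreover have "(SUP i\<in>I. b i) \<le> (SUP i\<in>I. a i) + e"
  proof (rule cSUP_least[OF assms(1)])
    fix i assume "i \<in> I"
    then show "b i \<le> (SUP i\<in>I. a i) + e"
      using ab[of i] cSUP_upper[OF _ assms(2), of i] by linarith
  qed
  ultimately show ?thesis by linarith
qed

lemma limitin_compose_filterlim:
  assumes "limitin X \<sigma> l F" "filterlim p F G"
  shows "limitin X (\<lambda>i. \<sigma> (p i)) l G"
  using assms(1) eventually_compose_filterlim[OF _ assms(2), of "\<lambda>n. \<sigma> n \<in> U" for U]
  by (simp add: limitin_def)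

section \<open>Slices, double limits and uniform convergence on compact sets\<close>

lemma s_continuous_prod_imp_continuous_map_right:
  assumes "s_continuous (prod_topology X Y) f" "Hausdorff_space Y" "sR_space Y" "x \<in> topspace X"
  shows "continuous_map Y euclideanreal (\<lambda>y. f (x, y))"
proof -
  have "s_continuous Y (\<lambda>y. f (x, y))"
  proof (rule s_continuousI[OF assms(2)])
    fix \<sigma> l assume "range \<sigma> \<subseteq> topspace Y" "limitin Y \<sigma> l sequentially"
    then show "(\<lambda>n. f (x, \<sigma> n)) \<longlonglongrightarrow> f (x, l)"
      using assms(4)
      by (intro s_continuous_imp_tendsto[OF assms(1)])
         (auto simp: limitin_pairwise comp_def limitin_const_iff)
  qed
  then show ?thesis
    using assms(3) by (auto simp: sR_space_def)
qed

text \<open>The sequence \<open>(x\<^sub>n, y\<^sub>k)\<close> converges along the product filter, although sequential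
  continuity only speaks about sequences.\<close>

lemma s_continuous_prod_double_limit:
  assumes f: "s_continuous (prod_topology X Y) f"
    and \<sigma>: "range \<sigma> \<subseteq> topspace X" "limitin X \<sigma> x sequentially"
    and \<tau>: "range \<tau> \<subseteq> topspace Y" "limitin Y \<tau> y sequentially"
    and e: "(e::real) > 0"
  obtains N where "\<And>n k. n \<ge> N \<Longrightarrow> k \<ge> N \<Longrightarrow> \<bar>f (\<sigma> n, \<tau> k) - f (x, y)\<bar> < e"
proof (rule ccontr)
  assume "\<not> thesis"
  then have "\<forall>N. \<exists>n k. n \<ge> N \<and> k \<ge> N \<and> \<not> \<bar>f (\<sigma> n, \<tau> k) - f (x, y)\<bar> < e"
    using that by blast
  \<comment> \<open>One bad pair for each \<open>N\<close> gives a single sequence tending to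
    \<open>(x, y)\<close> along which \<open>f\<close> stays at distance at least \<open>e\<close>
    from its limit value. Neither \<open>p\<close> nor \<open>q\<close> need be monotone:
    \<open>p N \<ge> N\<close> and \<open>q N \<ge> N\<close> force them to infinity.\<close>
  then obtain p q where pq: "\<And>N. p N \<ge> N" "\<And>N. q N \<ge> N"
      "\<And>N. \<not> \<bar>f (\<sigma> (p N), \<tau> (q N)) - f (x, y)\<bar> < e"
    by metis
  have "filterlim p sequentially sequentially" "filterlim q sequentially sequentially"
    by (rule filterlim_at_top_mono[OF filterlim_ident], simp add: pq)+
  then have "limitin X (\<lambda>N. \<sigma> (p N)) x sequentially" "limitin Y (\<lambda>N. \<tau> (q N)) y sequentially"
    by (simp_all add: limitin_compose_filterlim[OF \<sigma>(2)] limitin_compose_filterlim[OF \<tau>(2)])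
  then have "limitin (prod_topology X Y) (\<lambda>N. (\<sigma> (p N), \<tau> (q N))) (x, y) sequentially"
    by (simp add: limitin_pairwise comp_def)
  moreover have "range (\<lambda>N. (\<sigma> (p N), \<tau> (q N))) \<subseteq> topspace (prod_topology X Y)"
    using \<sigma>(1) \<tau>(1) by auto
  ultimately have "(\<lambda>N. f (\<sigma> (p N), \<tau> (q N))) \<longlonglongrightarrow> f (x, y)"
    using s_continuous_imp_tendsto[OF f] by blast
  then show False
    using pq(3) e by (auto simp: LIMSEQ_iff)
qed

lemma s_continuous_prod_uniform_limit:
  assumes f: "s_continuous (prod_topology X Y) f"
    and Y: "Hausdorff_space Y" "sR_space Y"
    and \<sigma>: "range \<sigma> \<subseteq> topspace X" "limitin X \<sigma> x sequentially"
    and K: "compactin Y K" and e: "(e::real) > 0"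
  obtains m where "\<And>n y. n \<ge> m \<Longrightarrow> y \<in> K \<Longrightarrow> \<bar>f (\<sigma> n, y) - f (x, y)\<bar> < e"
proof -
  define g where "g n y = \<bar>f (\<sigma> n, y) - f (x, y)\<bar>" for n y
  \<comment> \<open>A bound on \<open>G m y\<close> controls \<open>g n y\<close> for all
    \<open>n \<ge> m\<close> at once, so a finite subcover of \<open>K\<close> yields a common index
    although \<open>g n\<close> need not be monotone in \<open>n\<close>.\<close>
  define G where "G m y = (SUP n\<in>{m..}. g n y)" for m y
  have xX: "x \<in> topspace X"
    using \<sigma>(2) by (auto simp: limitin_def)
  have g_cont: "continuous_map Y euclideanreal (g n)" for n
    unfolding g_def
    by (intro continuous_map_real_abs continuous_map_diff
        s_continuous_prod_imp_continuous_map_right[OF f Y]) (use \<sigma>(1) xX in auto)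
  \<comment> \<open>Both \<open>f (\<sigma> n, \<tau> k)\<close> and \<open>f (x, \<tau> k)\<close>
    are close to \<open>f (x, y)\<close>; the second is the double limit for the constant sequence
    \<open>x\<close>.\<close>
  have g_small: "\<exists>N. \<forall>n\<ge>N. \<forall>k\<ge>N. g n (\<tau> k) < d"
    if \<tau>: "range \<tau> \<subseteq> topspace Y" "limitin Y \<tau> y sequentially" and "d > 0" for \<tau> y d
  proof -
    have "d / 2 > 0" using \<open>d > 0\<close> by simp
    then obtain N where N: "\<And>n k. n \<ge> N \<Longrightarrow> k \<ge> N \<Longrightarrow> \<bar>f (\<sigma> n, \<tau> k) - f (x, y)\<bar> < d / 2"
      using s_continuous_prod_double_limit[OF f \<sigma> \<tau>] by blast
    have "range (\<lambda>n::nat. x) \<subseteq> topspace X" "limitin X (\<lambda>n. x) x sequentially"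
      using xX by (auto simp: limitin_const_iff)
    then obtain M where M: "\<And>n k. n \<ge> M \<Longrightarrow> k \<ge> M \<Longrightarrow> \<bar>f (x, \<tau> k) - f (x, y)\<bar> < d / 2"
      using s_continuous_prod_double_limit[OF f _ _ \<tau> \<open>d / 2 > 0\<close>] by blast
    have "g n (\<tau> k) < d" if "n \<ge> max N M" "k \<ge> max N M" for n k
      using N[of n k] M[of n k] that unfolding g_def by (simp; arith)
    then show ?thesis by blast
  qed
  have g_small_pt: "\<exists>N. \<forall>n\<ge>N. g n y < d" if "y \<in> topspace Y" "d > 0" for y d
    using g_small[of "\<lambda>_. y" y d] that by (auto simp: limitin_const_iff)
  have g_bdd: "bdd_above ((\<lambda>n. g n y) ` {m..})" if yY: "y \<in> topspace Y" for m y
  proof -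
    obtain N where N: "\<forall>n\<ge>N. g n y < 1"
      using g_small_pt[OF yY zero_less_one] by blast
    then have "bdd_above ((\<lambda>n. g n y) ` {N..})"
      by (intro bdd_aboveI[of _ 1]) (auto intro: less_imp_le)
    then have "bdd_above ((\<lambda>n. g n y) ` {..N} \<union> (\<lambda>n. g n y) ` {N..})"
      by simp
    then show ?thesis
      by (rule bdd_above_mono) (unfold image_Un[symmetric], rule image_mono, auto)
  qed
  have "continuous_map Y euclideanreal (G m)" for m
  proof -
    have "s_continuous Y (G m)"
    proof (rule s_continuousI[OF Y(1)])
      fix \<tau> y assume \<tau>: "range \<tau> \<subseteq> topspace Y" "limitin Y \<tau> y sequentially"
      then have yY: "y \<in> topspace Y" by (auto simp: limitin_def)
      show "(\<lambda>k. G m (\<tau> k)) \<longlonglongrightarrow> G m y"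
      proof (rule LIMSEQ_I)
        fix r :: real assume r: "0 < r"
        then have r2: "r / 2 > 0" by simp
        obtain N where N: "\<forall>n\<ge>N. \<forall>k\<ge>N. g n (\<tau> k) < r / 2"
          using g_small[OF \<tau> r2] by blast
        obtain N' where N': "\<forall>n\<ge>N'. g n y < r / 2"
          using g_small_pt[OF yY r2] by blast
        \<comment> \<open>The finitely many indices below \<open>max N N'\<close> are handled by
          continuity of each \<open>g n\<close>; for the others both values lie in
          \<open>[0, r / 2)\<close>, so their difference is small as well.\<close>
        have "\<forall>\<^sub>F k in sequentially. \<bar>g n (\<tau> k) - g n y\<bar> < r / 2" for n
        proof -
          have "limitin euclideanreal (g n \<circ> \<tau>) (g n y) sequentially"
            using continuous_map_limit[OF g_cont \<tau>(2)] .
          then show ?thesis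
            using tendstoD[OF _ r2, of "\<lambda>k. g n (\<tau> k)"] by (simp add: comp_def dist_real_def)
        qed
        then have "\<forall>\<^sub>F k in sequentially. \<forall>n\<in>{..<max N N'}. \<bar>g n (\<tau> k) - g n y\<bar> < r / 2"
          by (intro eventually_ball_finite) auto
        then obtain M where M: "\<And>k n. k \<ge> M \<Longrightarrow> n < max N N' \<Longrightarrow> \<bar>g n (\<tau> k) - g n y\<bar> < r / 2"
          by (auto simp: eventually_sequentially)
        have "norm (G m (\<tau> k) - G m y) < r" if k: "k \<ge> max M N" for k
        proof -
          have "\<bar>g n (\<tau> k) - g n y\<bar> \<le> r / 2" for n
          proof (cases "n < max N N'")
            case True
            then show ?thesis using M[of k n] k by simp
          next
            case False
            then have "g n (\<tau> k) < r / 2" "g n y < r / 2" using N N' k by auto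
            moreover have "g n (\<tau> k) \<ge> 0" "g n y \<ge> 0" by (auto simp: g_def)
            ultimately show ?thesis by linarith
          qed
          then have "\<bar>G m (\<tau> k) - G m y\<bar> \<le> r / 2"
            unfolding G_def using \<tau>(1) yY by (intro abs_cSUP_diff_le g_bdd) auto
          then show ?thesis using r by simp
        qed
        then show "\<exists>no. \<forall>k\<ge>no. norm (G m (\<tau> k) - G m y) < r" by blast
      qed
    qed
    then show ?thesis using Y(2) by (auto simp: sR_space_def)
  qed
  then have U_open: "openin Y {y \<in> topspace Y. G m y \<in> {..<e}}" for m
    by (rule openin_continuous_map_preimage) auto
  let ?U = "\<lambda>m. {y \<in> topspace Y. G m y < e}"
  have cover: "K \<subseteq> \<Union>(range ?U)"
  proof
    fix y assume "y \<in> K"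
    then have yY: "y \<in> topspace Y" using compactin_subset_topspace[OF K] by blast
    \<comment> \<open>Halving \<open>e\<close> keeps the supremum strictly below \<open>e\<close>,
      since strict bounds on the terms only give a weak one on \<open>G N y\<close>.\<close>
    obtain N where N: "\<forall>n\<ge>N. g n y < e / 2"
      using g_small_pt[OF yY, of "e / 2"] e by auto
    have "G N y \<le> e / 2"
      unfolding G_def by (rule cSUP_least) (use N in \<open>auto intro: less_imp_le\<close>)
    then have "G N y < e" using e by simp
    then show "y \<in> \<Union>(range ?U)" using yY by blast
  qed
  have "openin Y V" if "V \<in> range ?U" for V
    using that U_open by auto
  then obtain \<F> where \<F>: "finite \<F>" "\<F> \<subseteq> range ?U" "K \<subseteq> \<Union>\<F>"
    using compactinD[OF K _ cover] by blast
  obtain I where I: "finite I" "K \<subseteq> \<Union>(?U ` I)"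
    using finite_subset_image[OF \<F>(1,2)] \<F>(3) by blast
  \<comment> \<open>The inserted \<open>0\<close> keeps \<open>Max\<close> meaningful when
    \<open>I\<close> is empty, as may happen for empty \<open>K\<close>.\<close>
  have "\<bar>f (\<sigma> n, y) - f (x, y)\<bar> < e" if n: "n \<ge> Max (insert 0 I)" and "y \<in> K" for n y
  proof -
    obtain i where i: "i \<in> I" "y \<in> topspace Y" "G i y < e"
      using I(2) \<open>y \<in> K\<close> by blast
    then have "i \<le> n"
      using n I(1) by (meson Max_ge finite_insert insertI2 order_trans)
    then have "g n y \<le> G i y"
      unfolding G_def by (intro cSUP_upper g_bdd i) auto
    then show ?thesis using i by (simp add: g_def)
  qed
  then show thesis using that by blast
qed

section \<open>Joint continuity from a compact neighbourhood in the second factor\<close>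

theorem theorem4p8:
  fixes X :: "'a topology" and Y :: "'b topology"
  assumes "tychonoff_space Y" and "locally_compact_space Y" and "sR_space Y"
    and "tychonoff_space X" and "sR_space X"
  shows "sR_space (prod_topology X Y)"
  unfolding sR_space_def
proof (intro allI impI)
  fix f :: "'a \<times> 'b \<Rightarrow> real"
  assume f: "s_continuous (prod_topology X Y) f"
  have HX: "Hausdorff_space X" and HY: "Hausdorff_space Y"
    using assms by (auto simp: tychonoff_space_def)
  note cont = s_continuous_prod_imp_continuous_map_right[OF f HY assms(3)]
  have "\<exists>U. openin (prod_topology X Y) U \<and> (x0, y0) \<in> U \<and> (\<forall>p\<in>U. \<bar>f p - f (x0, y0)\<bar> < e)"
    if x0: "x0 \<in> topspace X" and y0: "y0 \<in> topspace Y" and e: "e > 0" for x0 y0 e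
  proof -
    obtain V K where VK: "openin Y V" "compactin Y K" "y0 \<in> V" "V \<subseteq> K"
      using assms(2) y0 unfolding locally_compact_space_def by blast
    have KY: "K \<subseteq> topspace Y" using compactin_subset_topspace[OF VK(2)] .
    define F where "F x = (SUP y\<in>K. \<bar>f (x, y) - f (x0, y)\<bar>)" for x
    have bdd: "bdd_above ((\<lambda>y. \<bar>f (x, y) - f (x0, y)\<bar>) ` K)" if "x \<in> topspace X" for x
    proof -
      have "continuous_map Y euclideanreal (\<lambda>y. \<bar>f (x, y) - f (x0, y)\<bar>)"
        by (intro continuous_map_real_abs continuous_map_diff cont that x0)
      from image_compactin[OF VK(2) this] show ?thesis
        by (simp add: compact_imp_bounded bounded_imp_bdd_above)
    qed
    have "s_continuous X F"
    proof (rule s_continuousI[OF HX])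
      fix \<sigma> x assume \<sigma>: "range \<sigma> \<subseteq> topspace X" "limitin X \<sigma> x sequentially"
      then have xX: "x \<in> topspace X" by (auto simp: limitin_def)
      show "(\<lambda>n. F (\<sigma> n)) \<longlonglongrightarrow> F x"
      proof (rule LIMSEQ_I)
        fix r :: real assume r: "0 < r"
        then have "r / 2 > 0" by simp
        then obtain m where m: "\<And>n y. n \<ge> m \<Longrightarrow> y \<in> K \<Longrightarrow> \<bar>f (\<sigma> n, y) - f (x, y)\<bar> < r / 2"
          using s_continuous_prod_uniform_limit[OF f HY assms(3) \<sigma> VK(2)] by blast
        have "norm (F (\<sigma> n) - F x) < r" if n: "n \<ge> m" for n
        proof -
          have "\<bar>F (\<sigma> n) - F x\<bar> \<le> r / 2"
            unfolding F_def
          proof (intro abs_cSUP_diff_le bdd xX)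
            show "\<bar>\<bar>f (\<sigma> n, y) - f (x0, y)\<bar> - \<bar>f (x, y) - f (x0, y)\<bar>\<bar> \<le> r / 2" if "y \<in> K" for y
              using m[OF n that] by linarith
          qed (use \<sigma>(1) VK in auto)
          then show ?thesis using r by simp
        qed
        then show "\<exists>no. \<forall>n\<ge>no. norm (F (\<sigma> n) - F x) < r" by blast
      qed
    qed
    then have "continuous_map X euclideanreal F"
      using assms(5) by (auto simp: sR_space_def)
    then obtain A where A: "openin X A" "x0 \<in> A" "\<And>x. x \<in> A \<Longrightarrow> \<bar>F x - F x0\<bar> < e / 2"
      unfolding continuous_map_real_iff using x0 e by (metis half_gt_zero)
    obtain B where B: "openin Y B" "y0 \<in> B" "\<And>y. y \<in> B \<Longrightarrow> \<bar>f (x0, y) - f (x0, y0)\<bar> < e / 2"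
      using cont[OF x0] unfolding continuous_map_real_iff using y0 e by (metis half_gt_zero)
    \<comment> \<open>Nonemptiness matters: the supremum of the constant \<open>0\<close> is
      \<open>0\<close> only over a nonempty set.\<close>
    have "K \<noteq> {}" using VK by auto
    then have F0: "F x0 = 0" by (simp add: F_def)
    \<comment> \<open>The path goes through \<open>(x0, y)\<close>: \<open>F x\<close> bounds the
      first leg uniformly in \<open>y \<in> K\<close>, so \<open>A\<close> can be chosen
      independently of \<open>y\<close>, and \<open>B\<close> controls the second leg.\<close>
    have "\<bar>f (x, y) - f (x0, y0)\<bar> < e" if "x \<in> A" "y \<in> B \<inter> V" for x y
    proof -
      have "x \<in> topspace X" using A(1) that(1) openin_subset by blast
      then have "\<bar>f (x, y) - f (x0, y)\<bar> \<le> F x"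
        unfolding F_def by (rule cSUP_upper[OF _ bdd, rotated]) (use that VK in auto)
      then show ?thesis
        using A(3)[OF that(1)] B(3)[of y] that(2) F0 by (simp; arith)
    qed
    moreover have "openin (prod_topology X Y) (A \<times> (B \<inter> V))"
      using A B VK by (simp add: openin_prod_Times_iff openin_Int)
    ultimately show ?thesis
      using A(2) B(2) VK(3) by (intro exI[of _ "A \<times> (B \<inter> V)"]) auto
  qed
  then show "continuous_map (prod_topology X Y) euclideanreal f"
    unfolding continuous_map_real_iff by auto
qed

end
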